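(* There do not exist $k\in\mathbb{N}$ and a $k$-color edge coloring model $h\in(SV_k)^*$ such that $p_h(G)=p(G;0)$ for all graphs $G$ (having no component equal to the circle $\bigcirc$), where $p(G;t)=\det(tI-A)$ is the characteristic polynomial of $G$.
   Context: $\mathbb{N}=\mathbb{Z}_{\ge 0}$ and $[k]=\{1,\dots,k\}$. All graphs are finite and may have loops and multiple edges. The circle $\bigcirc$ is the graph consisting of a single edge with empty vertex set; graphs here are assumed not to have $\bigcirc$ as a connected component. The adjacency matrix $A$ of a graph $G=(V,E)$ is the $V\times V$ matrix for which $A(i,j)$, $i\ne j$, is the multiplicity of the edge $\{i,j\}$ in $E$, and $A(i,i)$ is twice the number of loops at $i$. The characteristic polynomial is $p(G;t):=\det(tI-A)$. $V_k$ is a complex vector space with basis $e_1,\dots,e_k$ and $SV_k$ is its symmetric algebra, with product written $\odot$ (the empty product being $1$). A $k$-color edge coloring model is an element $h$ of the full linear dual $(SV_k)^*$. Its partition function $p_h$ is defined for a graph $G=(V,E)$ by $$p_h(G):=\sum_{\phi:E\to[k]}\prod_{v\in V}h\Big(\bigodot_{a\in\delta(v)}e_{\phi(a)}\Big),$$ where $\delta(v)$ is the collection of edges incident with $v$, a loop at $v$ occurring twice. *)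

theory Defs
  imports
    "HOL-Library.Multiset"
    "HOL-Library.FuncSet"
    "HOL-Library.Poly_Mapping"
    "Jordan_Normal_Form.Char_Poly"
begin

text \<open>
  Finite graphs with loops and multiple edges. The ends of an edge form a two-element multiset,
  so that a loop at \<open>v\<close> has ends \<open>{#v, v#}\<close>. As every edge has its two ends in the vertex set,
  no such graph has the vertexless circle as a connected component.
\<close>

record ('v, 'e) multigraph =
  verts :: "'v set"
  edges :: "'e set"
  ends :: "'e \<Rightarrow> 'v multiset"

definition is_graph :: "('v, 'e) multigraph \<Rightarrow> bool" where
  "is_graph G \<longleftrightarrow> finite (verts G) \<and> finite (edges G) \<and>
     (\<forall>e\<in>edges G. size (ends G e) = 2 \<and> set_mset (ends G e) \<subseteq> verts G)"

text \<open>The edges incident with \<open>v\<close>, where a loop at \<open>v\<close> is counted twice.\<close>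

definition incident_edges :: "('v, 'e) multigraph \<Rightarrow> 'v \<Rightarrow> 'e multiset" where
  "incident_edges G v = (\<Sum>e\<in>edges G. replicate_mset (count (ends G e) v) e)"

definition adjacency :: "('v, 'e) multigraph \<Rightarrow> 'v \<Rightarrow> 'v \<Rightarrow> nat" where
  "adjacency G i j =
     (if i = j then 2 * card {e \<in> edges G. ends G e = {#i, i#}}
      else card {e \<in> edges G. ends G e = {#i, j#}})"

text \<open>
  Library matrices are indexed by initial segments of the natural numbers, so the vertices
  are listed in increasing order; the determinant does not depend on this choice.
\<close>

definition adjacency_matrix :: "('v::linorder, 'e) multigraph \<Rightarrow> complex mat" where
  "adjacency_matrix G =
     (let vs = sorted_list_of_set (verts G)
      in mat (length vs) (length vs) (\<lambda>(i, j). of_nat (adjacency G (vs ! i) (vs ! j))))"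

definition characteristic_polynomial :: "('v::linorder, 'e) multigraph \<Rightarrow> complex poly" where
  "characteristic_polynomial G = char_poly (adjacency_matrix G)"

text \<open>
  The symmetric algebra of the complex vector space with basis \<open>e\<^sub>1, \<dots>, e\<^sub>k\<close> is the polynomial
  algebra in the \<open>e\<^sub>i\<close>. An exponent vector \<open>m :: nat \<Rightarrow>\<^sub>0 nat\<close> stands for the product of the
  powers of \<open>e\<^sub>i\<close> with exponent \<open>m i\<close>, a finitely supported map from exponent vectors to
  coefficients is a polynomial, and the symmetric product is the multiplication of the type.
\<close>

type_synonym sym_tensor = "(nat \<Rightarrow>\<^sub>0 nat) \<Rightarrow>\<^sub>0 complex"

definition sym_algebra :: "nat \<Rightarrow> sym_tensor set" where
  "sym_algebra k = {p. \<forall>m\<in>Poly_Mapping.keys p. Poly_Mapping.keys m \<subseteq> {1..k}}"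

definition basis_vec :: "nat \<Rightarrow> sym_tensor" where
  "basis_vec i = Poly_Mapping.single (Poly_Mapping.single i 1) 1"

definition scale_sym :: "complex \<Rightarrow> sym_tensor \<Rightarrow> sym_tensor" where
  "scale_sym c p = Poly_Mapping.map ((*) c) p"

text \<open>
  An arbitrary linear functional on \<^term>\<open>sym_algebra k\<close>; it need not be multiplicative, and its
  values outside \<^term>\<open>sym_algebra k\<close> are irrelevant.
\<close>

definition edge_coloring_model :: "nat \<Rightarrow> (sym_tensor \<Rightarrow> complex) \<Rightarrow> bool" where
  "edge_coloring_model k h \<longleftrightarrow>
     (\<forall>p\<in>sym_algebra k. \<forall>q\<in>sym_algebra k. h (p + q) = h p + h q) \<and>
     (\<forall>c. \<forall>p\<in>sym_algebra k. h (scale_sym c p) = c * h p)"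

definition partition_function ::
  "nat \<Rightarrow> (sym_tensor \<Rightarrow> complex) \<Rightarrow> ('v, 'e) multigraph \<Rightarrow> complex" where
  "partition_function k h G =
     (\<Sum>\<phi>\<in>edges G \<rightarrow>\<^sub>E {1..k}. \<Prod>v\<in>verts G. h (\<Prod>a\<in>#incident_edges G v. basis_vec (\<phi> a)))"

end

theory Submission
  imports Defs "Jordan_Normal_Form.Schur_Decomposition"
begin

text \<open>
  Let \<open>C\<^sub>n\<close> be the cycle with \<open>n\<close> vertices (a loop for \<open>n = 1\<close>) and \<open>B\<close> the \<open>k \<times> k\<close> matrix with
  entries \<open>h (e\<^sub>i \<odot> e\<^sub>j)\<close>. Colorings of the edges of \<open>C\<^sub>n\<close> are closed walks of length \<open>n\<close> on the
  set of colors, so \<open>p\<^sub>h(C\<^sub>n) = tr (B\<^sup>n)\<close>. If \<open>4\<close> divides \<open>n\<close> then the adjacency matrix of \<open>C\<^sub>n\<close> has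
  the kernel vector \<open>(1, 0, -1, 0, 1, 0, -1, 0, \<dots>)\<close>. Hence all powers of \<open>B\<^sup>4\<close> would have trace
  zero, so that \<open>B\<close> would have no nonzero eigenvalue and \<open>tr B = 0\<close>; but the loop \<open>C\<^sub>1\<close> has
  \<open>p(C\<^sub>1; 0) = -2\<close>.
\<close>

section \<open>Traces of matrix powers\<close>

definition mat_trace :: "'a :: comm_monoid_add mat \<Rightarrow> 'a" where
  "mat_trace A = (\<Sum>i<dim_row A. A $$ (i, i))"

lemma mat_trace_mult:
  assumes "A \<in> carrier_mat n m" "B \<in> carrier_mat m n"
  shows "mat_trace (A * B) = (\<Sum>i<n. \<Sum>j<m. A $$ (i, j) * B $$ (j, i))"
  using assms by (auto simp: mat_trace_def scalar_prod_def atLeast0LessThan intro!: sum.cong)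

lemma mat_trace_comm:
  fixes A B :: "'a :: comm_semiring_0 mat"
  assumes "A \<in> carrier_mat n m" "B \<in> carrier_mat m n"
  shows "mat_trace (A * B) = mat_trace (B * A)"
  unfolding mat_trace_mult[OF assms] mat_trace_mult[OF assms(2,1)]
  by (subst sum.swap) (simp add: mult.commute)

lemma mat_trace_similar:
  fixes A B :: "'a :: comm_ring_1 mat"
  assumes "similar_mat_wit A B P Q"
  shows "mat_trace A = mat_trace B"
proof -
  note wit = similar_mat_witD[OF refl assms]
  have "mat_trace A = mat_trace (P * (B * Q))"
    using wit by (metis assoc_mult_mat)
  also have "\<dots> = mat_trace (B * Q * P)"
    by (rule mat_trace_comm[OF wit(6) mult_carrier_mat[OF wit(5,7)]])
  also have "B * Q * P = B"
    using wit by (metis assoc_mult_mat right_mult_one_mat)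
  finally show ?thesis .
qed

text \<open>In row \<open>i\<close> of the product, indices \<open>l < i\<close> are killed by
  \<open>A\<close> and those above the column index by \<open>B\<close>; on the diagonal only
  \<open>l = i\<close> survives.\<close>

lemma upper_triangular_mult_diag:
  fixes A B :: "'a :: semiring_0 mat"
  assumes A: "A \<in> carrier_mat n n" "upper_triangular A"
    and B: "B \<in> carrier_mat n n" "upper_triangular B"
  shows "upper_triangular (A * B)"
    and "i < n \<Longrightarrow> (A * B) $$ (i, i) = A $$ (i, i) * B $$ (i, i)"
proof -
  have entry: "(A * B) $$ (i, j) = (\<Sum>l<n. A $$ (i, l) * B $$ (l, j))" if "i < n" "j < n" for i j
    using that A B by (auto simp: scalar_prod_def atLeast0LessThan)
  show "upper_triangular (A * B)"
  proof
    fix i j assume ij: "j < i" "i < dim_row (A * B)"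
    have "A $$ (i, l) * B $$ (l, j) = 0" if "l < n" for l
    proof (cases "l < i")
      case True
      with ij A show ?thesis by (auto simp: upper_triangularD)
    next
      case False
      with ij that B show ?thesis by (auto simp: upper_triangularD)
    qed
    then show "(A * B) $$ (i, j) = 0" using ij A by (simp add: entry)
  qed
  assume i: "i < n"
  have "A $$ (i, l) * B $$ (l, i) = 0" if "l < n" "l \<noteq> i" for l
    using that i A B by (cases "l < i") (auto simp: upper_triangularD)
  then have "(\<Sum>l<n. A $$ (i, l) * B $$ (l, i)) = (\<Sum>l\<in>{i}. A $$ (i, l) * B $$ (l, i))"
    using i by (intro sum.mono_neutral_right) auto
  then show "(A * B) $$ (i, i) = A $$ (i, i) * B $$ (i, i)" using i by (simp add: entry)
qed

lemma upper_triangular_pow_diag: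
  fixes A :: "'a :: semiring_1 mat"
  assumes "A \<in> carrier_mat n n" "upper_triangular A"
  shows "upper_triangular (A ^\<^sub>m r) \<and> (\<forall>i<n. (A ^\<^sub>m r) $$ (i, i) = A $$ (i, i) ^ r)"
proof (induction r)
  case 0
  then show ?case using assms by auto
next
  case (Suc r)
  then show ?case
    using assms upper_triangular_mult_diag[OF pow_carrier_mat[OF assms(1)] _ assms, of r]
    by (simp add: power_commutes)
qed

text \<open>The \<open>f i\<close> are the diagonal entries of a Schur form, that is, the
  eigenvalues with multiplicity; the same \<open>f\<close> serves every exponent.\<close>

lemma mat_trace_pow_eigenvalues:
  fixes A :: "complex mat"
  assumes A: "A \<in> carrier_mat n n"
  obtains f :: "nat \<Rightarrow> complex" where "\<And>r. mat_trace (A ^\<^sub>m r) = (\<Sum>i<n. f i ^ r)"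
proof -
  obtain es where "char_poly A = (\<Prod>a\<leftarrow>es. [:- a, 1:])"
    using char_poly_factorized[OF A] by blast
  from schur_decomposition_exists[OF A this]
  obtain T P Q where T: "T \<in> carrier_mat n n" "upper_triangular T"
    and sim: "similar_mat_wit A T P Q"
    by (auto simp: similar_mat_def)
  have "mat_trace (A ^\<^sub>m r) = (\<Sum>i<n. T $$ (i, i) ^ r)" for r
    using mat_trace_similar[OF similar_mat_wit_pow[OF sim, of r]]
      upper_triangular_pow_diag[OF T, of r] T
    by (simp add: mat_trace_def)
  then show ?thesis by (rule that)
qed

text \<open>By linearity every polynomial without constant term also sums to zero over the values of
  \<open>f\<close>; one of them isolates a nonzero value.\<close>

lemma power_sums_zero_imp_zero:
  fixes f :: "'b \<Rightarrow> 'a :: field_char_0"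
  assumes fin: "finite S" and zero: "\<And>m. m > 0 \<Longrightarrow> (\<Sum>i\<in>S. f i ^ m) = 0"
    and a: "a \<in> S"
  shows "f a = 0"
proof (rule ccontr)
  assume nz: "f a \<noteq> 0"
  \<comment> \<open>\<open>p\<close> vanishes at every value other than \<open>f a\<close>; the
    factor \<open>[:0, 1:]\<close> removes the constant term, as nothing is assumed about the
    exponent 0.\<close>
  define p where "p = [:0, 1:] * (\<Prod>\<mu>\<in>f ` S - {f a}. [:- \<mu>, 1:])"
  have p_eq_0: "poly p (f i) = 0" if "i \<in> S" "f i \<noteq> f a" for i
    using that fin by (auto simp: p_def poly_prod)
  have p_a: "poly p (f a) \<noteq> 0"
    using fin nz by (auto simp: p_def poly_prod)
  have p0: "coeff p 0 = 0" by (simp add: p_def)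
  have "(\<Sum>i\<in>S. poly p (f i)) = (\<Sum>j\<le>degree p. coeff p j * (\<Sum>i\<in>S. f i ^ j))"
    by (simp add: poly_altdef sum_distrib_left) (rule sum.swap)
  also have "\<dots> = 0"
    using zero p0 by (intro sum.neutral) (metis gr0I mult_eq_0_iff)
  finally have "0 = (\<Sum>i\<in>S. poly p (f i))" by simp
  also have "\<dots> = (\<Sum>i\<in>{i \<in> S. f i = f a}. poly p (f i))"
    using fin p_eq_0 by (intro sum.mono_neutral_right) auto
  \<comment> \<open>The value \<open>f a\<close> is attained, and in characteristic zero its
    multiplicity is nonzero.\<close>
  also have "\<dots> = of_nat (card {i \<in> S. f i = f a}) * poly p (f a)" by simp
  finally show False using fin a p_a by auto
qed

text \<open>The \<open>d\<close>-th powers of the eigenvalues have vanishing power sums, so every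
  eigenvalue is zero.\<close>

lemma mat_trace_zero_of_pow_traces_zero:
  fixes A :: "complex mat"
  assumes A: "A \<in> carrier_mat n n" and d: "d > 0"
    and zero: "\<And>m. m > 0 \<Longrightarrow> mat_trace (A ^\<^sub>m (d * m)) = 0"
  shows "mat_trace A = 0"
proof -
  obtain f :: "nat \<Rightarrow> complex" where f: "\<And>r. mat_trace (A ^\<^sub>m r) = (\<Sum>i<n. f i ^ r)"
    using mat_trace_pow_eigenvalues[OF A] by blast
  have "f i ^ d = 0" if "i < n" for i
    by (rule power_sums_zero_imp_zero[of "{..<n}" "\<lambda>i. f i ^ d"])
      (use zero that in \<open>auto simp: f power_mult\<close>)
  then have "(\<Sum>i<n. f i ^ 1) = 0" by simp
  with f[of 1] A show ?thesis by simp
qed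

section \<open>Sums over walks\<close>

lemma sum_PiE_insert:
  assumes "x \<notin> S"
  shows "(\<Sum>\<phi>\<in>insert x S \<rightarrow>\<^sub>E T. F \<phi>) = (\<Sum>\<phi>\<in>S \<rightarrow>\<^sub>E T. \<Sum>y\<in>T. F (\<phi>(x := y)))"
proof -
  have "(\<Sum>\<phi>\<in>insert x S \<rightarrow>\<^sub>E T. F \<phi>) = (\<Sum>(y, \<phi>)\<in>T \<times> (S \<rightarrow>\<^sub>E T). F (\<phi>(x := y)))"
    unfolding PiE_insert_eq using inj_combinator[OF assms, of "\<lambda>_. T"]
    by (subst sum.reindex) (auto simp: case_prod_unfold)
  also have "\<dots> = (\<Sum>y\<in>T. \<Sum>\<phi>\<in>S \<rightarrow>\<^sub>E T. F (\<phi>(x := y)))"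
    by (rule sum.cartesian_product[symmetric])
  finally show ?thesis by (simp add: sum.swap[of _ T])
qed

text \<open>The weight \<open>g\<close> of the two ends is left arbitrary to make the induction go through.\<close>

lemma sum_walks:
  fixes b g :: "'b \<Rightarrow> 'b \<Rightarrow> 'a :: comm_semiring_1" and W :: "nat \<Rightarrow> 'b \<Rightarrow> 'b \<Rightarrow> 'a"
  assumes fin: "finite S"
    and W0: "\<And>i j. i \<in> S \<Longrightarrow> j \<in> S \<Longrightarrow> W 0 i j = (if i = j then 1 else 0)"
    and WSuc: "\<And>n i j. i \<in> S \<Longrightarrow> j \<in> S \<Longrightarrow> W (Suc n) i j = (\<Sum>l\<in>S. W n i l * b l j)"
  shows "(\<Sum>\<phi>\<in>{..n} \<rightarrow>\<^sub>E S. (\<Prod>v<n. b (\<phi> v) (\<phi> (Suc v))) * g (\<phi> 0) (\<phi> n)) =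
    (\<Sum>i\<in>S. \<Sum>j\<in>S. W n i j * g i j)"
proof (induction n arbitrary: g)
  case 0
  have "(\<Sum>\<phi>\<in>{..0::nat} \<rightarrow>\<^sub>E S. g (\<phi> 0) (\<phi> 0)) = (\<Sum>i\<in>S. g i i)"
    using sum_PiE_insert[of "0::nat" "{}" "\<lambda>\<phi>. g (\<phi> 0) (\<phi> 0)" S] by simp
  also have "\<dots> = (\<Sum>i\<in>S. \<Sum>j\<in>S. (if i = j then g i j else 0))"
    using fin by simp
  also have "\<dots> = (\<Sum>i\<in>S. \<Sum>j\<in>S. W 0 i j * g i j)"
    by (intro sum.cong) (auto simp: W0)
  finally show ?case by simp
next
  case (Suc n)
  \<comment> \<open>The last color is summed out first; its factor \<open>b\<close> is absorbed into
    a new end weight, to which the induction hypothesis applies.\<close>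
  have "(\<Sum>\<phi>\<in>{..Suc n} \<rightarrow>\<^sub>E S. (\<Prod>v<Suc n. b (\<phi> v) (\<phi> (Suc v))) * g (\<phi> 0) (\<phi> (Suc n))) =
    (\<Sum>\<phi>\<in>{..n} \<rightarrow>\<^sub>E S. (\<Prod>v<n. b (\<phi> v) (\<phi> (Suc v))) * (\<Sum>j\<in>S. b (\<phi> n) j * g (\<phi> 0) j))"
    by (simp add: atMost_Suc sum_PiE_insert sum_distrib_left mult.assoc)
  also have "\<dots> = (\<Sum>i\<in>S. \<Sum>l\<in>S. W n i l * (\<Sum>j\<in>S. b l j * g i j))"
    by (rule Suc.IH)
  also have "\<dots> = (\<Sum>i\<in>S. \<Sum>j\<in>S. \<Sum>l\<in>S. W n i l * (b l j * g i j))"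
    by (simp add: sum_distrib_left) (intro sum.cong refl sum.swap)
  also have "\<dots> = (\<Sum>i\<in>S. \<Sum>j\<in>S. W (Suc n) i j * g i j)"
    by (intro sum.cong refl) (simp add: WSuc sum_distrib_right mult.assoc)
  finally show ?case .
qed

lemma sum_closed_walks_eq_trace:
  fixes b :: "nat \<Rightarrow> nat \<Rightarrow> 'a :: comm_semiring_1"
  defines "A \<equiv> \<lambda>k. mat k k (\<lambda>(i, j). b (Suc i) (Suc j))"
  shows "(\<Sum>\<phi>\<in>{..n} \<rightarrow>\<^sub>E {1..k}. (\<Prod>v<n. b (\<phi> v) (\<phi> (Suc v))) * b (\<phi> n) (\<phi> 0)) =
    mat_trace (A k ^\<^sub>m Suc n)"
proof -
  have A: "A k \<in> carrier_mat k k" by (simp add: A_def)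
  \<comment> \<open>Colors run from 1 to \<open>k\<close>, matrix indices from 0 to
    \<open>k - 1\<close>.\<close>
  have shift: "(\<Sum>l<k. F (Suc l)) = (\<Sum>l\<in>{1..k}. F l)" for F :: "nat \<Rightarrow> 'a"
    by (rule sum.reindex_bij_witness[of _ "\<lambda>l. l - 1" Suc]) auto
  have "(\<Sum>\<phi>\<in>{..n} \<rightarrow>\<^sub>E {1..k}. (\<Prod>v<n. b (\<phi> v) (\<phi> (Suc v))) * b (\<phi> n) (\<phi> 0)) =
    (\<Sum>i\<in>{1..k}. \<Sum>j\<in>{1..k}. (A k ^\<^sub>m n) $$ (i - 1, j - 1) * b j i)"
  \<comment> \<open>The end weight is the closing step from the last color \<open>j\<close> back to
    the first color \<open>i\<close>, hence the swapped arguments.\<close>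
  proof (rule sum_walks[where g = "\<lambda>i j. b j i"])
    fix i j assume "i \<in> {1..k}" "j \<in> {1..k}"
    then show "(A k ^\<^sub>m 0) $$ (i - 1, j - 1) = (if i = j then 1 else 0)"
      using A by auto
  next
    fix r i j assume "i \<in> {1..k}" "j \<in> {1..k}"
    then have ij: "i - 1 < k" "j - 1 < k" "Suc (j - 1) = j" by auto
    have "(A k ^\<^sub>m Suc r) $$ (i - 1, j - 1) =
        (\<Sum>l<k. (A k ^\<^sub>m r) $$ (i - 1, l) * A k $$ (l, j - 1))"
      using ij A pow_carrier_mat[OF A, of r]
      by (auto simp: scalar_prod_def atLeast0LessThan)
    also have "\<dots> = (\<Sum>l<k. (A k ^\<^sub>m r) $$ (i - 1, Suc l - 1) * b (Suc l) j)"
      using ij by (intro sum.cong) (auto simp: A_def)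
    finally show "(A k ^\<^sub>m Suc r) $$ (i - 1, j - 1) =
        (\<Sum>l\<in>{1..k}. (A k ^\<^sub>m r) $$ (i - 1, l - 1) * b l j)"
      using shift[of "\<lambda>l. (A k ^\<^sub>m r) $$ (i - 1, l - 1) * b l j"] by metis
  qed simp
  also have "\<dots> = (\<Sum>i<k. \<Sum>j<k. (A k ^\<^sub>m n) $$ (i, j) * b (Suc j) (Suc i))"
    unfolding shift[symmetric] by simp
  also have "\<dots> = (\<Sum>i<k. \<Sum>j<k. (A k ^\<^sub>m n) $$ (i, j) * A k $$ (j, i))"
    by (intro sum.cong) (auto simp: A_def)
  also have "\<dots> = mat_trace (A k ^\<^sub>m Suc n)"
    using mat_trace_mult[OF pow_carrier_mat[OF A] A, of n] by simp
  finally show ?thesis .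
qed

section \<open>Cycles\<close>

definition cyc_succ :: "nat \<Rightarrow> nat \<Rightarrow> nat" where
  "cyc_succ n v = (if v = n then 0 else Suc v)"

lemma cyc_succ_eq_iff: "u \<le> n \<Longrightarrow> v \<le> n \<Longrightarrow> cyc_succ n u = cyc_succ n v \<longleftrightarrow> u = v"
  by (auto simp: cyc_succ_def)

text \<open>The cycle with \<open>n + 1\<close> vertices, which is a loop for \<open>n = 0\<close> and a double edge for \<open>n = 1\<close>.\<close>

definition cycle_graph :: "nat \<Rightarrow> (nat, nat) multigraph" where
  "cycle_graph n = \<lparr>verts = {..n}, edges = {..n}, ends = \<lambda>e. {#e, cyc_succ n e#}\<rparr>"

lemma is_graph_cycle: "is_graph (cycle_graph n)"
  by (auto simp: is_graph_def cycle_graph_def cyc_succ_def)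

text \<open>A vertex meets the edge with its own number and the edge of its predecessor; writing it
  as a successor gives the predecessor the name \<open>u\<close>. For \<open>n = 0\<close> both are
  the same loop, counted twice.\<close>

lemma incident_edges_cycle:
  assumes "u \<le> n"
  shows "incident_edges (cycle_graph n) (cyc_succ n u) = {#u, cyc_succ n u#}"
proof -
  have eq: "replicate_mset (count (ends (cycle_graph n) e) (cyc_succ n u)) e =
      (if e = cyc_succ n u then {#e#} else {#}) + (if e = u then {#e#} else {#})"
    if "e \<le> n" for e
    using cyc_succ_eq_iff[OF that assms]
    by (cases "e = u"; cases "e = cyc_succ n u") (auto simp: cycle_graph_def)
  have "incident_edges (cycle_graph n) (cyc_succ n u) =
      (\<Sum>e\<le>n. (if e = cyc_succ n u then {#e#} else {#}) + (if e = u then {#e#} else {#}))"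
    unfolding incident_edges_def
  proof (intro sum.cong)
    show "edges (cycle_graph n) = {..n}" by (simp add: cycle_graph_def)
  qed (simp only: eq atMost_iff)
  also have "\<dots> = {#cyc_succ n u#} + {#u#}"
    using assms by (subst sum.distrib) (auto simp: cyc_succ_def)
  finally show ?thesis by simp
qed

lemma partition_function_cycle:
  "partition_function k h (cycle_graph n) =
    mat_trace (mat k k (\<lambda>(i, j). h (basis_vec (Suc i) * basis_vec (Suc j))) ^\<^sub>m Suc n)"
proof -
  let ?b = "\<lambda>i j. h (basis_vec i * basis_vec j)"
  have "(\<Prod>v\<le>n. h (\<Prod>a\<in>#incident_edges (cycle_graph n) v. basis_vec (\<phi> a))) =
      (\<Prod>v<n. ?b (\<phi> v) (\<phi> (Suc v))) * ?b (\<phi> n) (\<phi> 0)" (is "prod ?F _ = _") for \<phi> :: "nat \<Rightarrow> nat"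
  proof -
    have "prod ?F {..n} = (\<Prod>u\<le>n. ?F (cyc_succ n u))"
      by (rule prod.reindex_bij_witness
            [of _ "cyc_succ n" "\<lambda>v. if v = 0 then n else v - 1"])
        (auto simp: cyc_succ_def)
    also have "\<dots> = (\<Prod>u\<le>n. ?b (\<phi> u) (\<phi> (cyc_succ n u)))"
      by (intro prod.cong) (auto simp: incident_edges_cycle)
    also have "\<dots> = (\<Prod>u<n. ?b (\<phi> u) (\<phi> (Suc u))) * ?b (\<phi> n) (\<phi> 0)"
      by (simp add: lessThan_Suc_atMost[symmetric] cyc_succ_def)
    finally show ?thesis .
  qed
  then show ?thesis
    unfolding partition_function_def
    using sum_closed_walks_eq_trace[where b = ?b] by (simp add: cycle_graph_def)
qed

lemma adjacency_cycle:
  assumes "n \<ge> 2" "i \<le> n" "j \<le> n"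
  shows "adjacency (cycle_graph n) i j =
    (if j = cyc_succ n i then 1 else 0) + (if i = cyc_succ n j then 1 else 0)"
proof -
  have "{e \<in> edges (cycle_graph n). ends (cycle_graph n) e = {#i, j#}} =
      (if j = cyc_succ n i then {i} else {}) \<union> (if i = cyc_succ n j then {j} else {})"
    using assms by (auto simp: cycle_graph_def add_eq_conv_ex)
  moreover have "adjacency (cycle_graph n) i j =
      (if i = j then 2 else 1) * card {e \<in> edges (cycle_graph n). ends (cycle_graph n) e = {#i, j#}}"
    by (simp add: adjacency_def)
  ultimately show ?thesis
    using assms by (auto simp: cyc_succ_def)
qed

lemma adjacency_matrix_cycle:
  "adjacency_matrix (cycle_graph n) =
    mat (Suc n) (Suc n) (\<lambda>(i, j). of_nat (adjacency (cycle_graph n) i j))"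
proof -
  have "sorted_list_of_set {..n} = [0..<Suc n]"
    by (metis atLeast0LessThan lessThan_Suc_atMost sorted_list_of_set_range)
  then show ?thesis
    unfolding adjacency_matrix_def Let_def
    by (intro eq_matI) (auto simp: cycle_graph_def simp del: upt_Suc)
qed

lemma characteristic_polynomial_loop:
  "poly (characteristic_polynomial (cycle_graph 0)) 0 = -2"
proof -
  have "{e. e = (0::nat) \<and> {#e, cyc_succ 0 e#} = {#0, 0#}} = {0}"
    by (auto simp: cyc_succ_def)
  then have "adjacency (cycle_graph 0) 0 0 = 2"
    by (simp add: adjacency_def cycle_graph_def)
  then show ?thesis
    by (simp add: characteristic_polynomial_def adjacency_matrix_cycle char_poly_def
        char_poly_matrix_def det_single)
qed

lemma characteristic_polynomial_cycle_4:
  assumes n: "Suc n = 4 * m"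
  shows "poly (characteristic_polynomial (cycle_graph n)) 0 = 0"
proof -
  let ?A = "adjacency_matrix (cycle_graph n)"
  define w :: "nat \<Rightarrow> complex" where
    "w j = (if j mod 4 = 0 then 1 else if j mod 4 = 2 then -1 else 0)" for j
  have n2: "n \<ge> 2" using n by arith
  have A: "?A \<in> carrier_mat (Suc n) (Suc n)" by (simp add: adjacency_matrix_cycle)
  have ker: "(\<Sum>j\<le>n. of_nat (adjacency (cycle_graph n) i j) * w j) = 0" if i: "i \<le> n" for i
  proof -
    let ?pred = "if i = 0 then n else i - 1"
    have "(\<Sum>j\<le>n. of_nat (adjacency (cycle_graph n) i j) * w j) =
        (\<Sum>j\<le>n. (if j = cyc_succ n i then w j else 0) + (if j = ?pred then w j else 0))"
    proof (intro sum.cong refl)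
      fix j assume "j \<in> {..n}"
      then have j: "j \<le> n" by simp
      then have "i = cyc_succ n j \<longleftrightarrow> j = ?pred" using i by (auto simp: cyc_succ_def)
      then show "of_nat (adjacency (cycle_graph n) i j) * w j =
          (if j = cyc_succ n i then w j else 0) + (if j = ?pred then w j else 0)"
        unfolding adjacency_cycle[OF n2 i j] by simp
    qed
    also have "\<dots> = w (cyc_succ n i) + w ?pred"
      using i by (subst sum.distrib) (auto simp: cyc_succ_def)
    also have "\<dots> = 0"
    proof -
      have n3: "n mod 4 = 3" using n by presburger
      consider "i = 0" | i' where "i = Suc i'" "i < n" | "i = n"
        using i by (metis le_neq_implies_less not0_implies_Suc)
      then show ?thesis
      proof cases
        case 1
        with n2 n3 show ?thesis by (simp add: w_def cyc_succ_def)
      next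
        case 2
        have "i' mod 4 = 0 \<longleftrightarrow> Suc (Suc i') mod 4 = 2" "i' mod 4 = 2 \<longleftrightarrow> Suc (Suc i') mod 4 = 0"
          by presburger+
        with 2 show ?thesis by (simp add: w_def cyc_succ_def)
      next
        case 3
        obtain n' where n': "n = Suc n'" using n2 by (cases n) auto
        with n3 have "n' mod 4 = 2" by (simp add: mod_Suc split: if_splits)
        with 3 n' show ?thesis by (simp add: w_def cyc_succ_def)
      qed
    qed
    finally show ?thesis .
  qed
  have "eigenvector ?A (vec (Suc n) w) 0"
    unfolding eigenvector_def
  proof (intro conjI)
    have "vec (Suc n) w $ 0 \<noteq> 0\<^sub>v (Suc n) $ 0" by (simp add: w_def)
    then have "vec (Suc n) w \<noteq> 0\<^sub>v (Suc n)" by metis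
    then show "vec (Suc n) w \<noteq> 0\<^sub>v (dim_row ?A)" using A by simp
    show "?A *\<^sub>v vec (Suc n) w = 0 \<cdot>\<^sub>v vec (Suc n) w"
      using ker
      by (intro eq_vecI)
        (auto simp: adjacency_matrix_cycle scalar_prod_def atLeast0LessThan lessThan_Suc_atMost
          simp del: sum.lessThan_Suc)
  qed (use A in auto)
  then have "eigenvalue ?A 0" by (auto simp: eigenvalue_def)
  then show ?thesis
    using eigenvalue_root_char_poly[OF A] by (simp add: characteristic_polynomial_def)
qed

theorem proposition9:
  "\<not> (\<exists>(k::nat) (h :: sym_tensor \<Rightarrow> complex). edge_coloring_model k h \<and>
        (\<forall>G :: (nat, nat) multigraph. is_graph G \<longrightarrow>
           partition_function k h G = poly (characteristic_polynomial G) 0))"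
proof
  assume "\<exists>(k::nat) (h :: sym_tensor \<Rightarrow> complex). edge_coloring_model k h \<and>
        (\<forall>G :: (nat, nat) multigraph. is_graph G \<longrightarrow>
           partition_function k h G = poly (characteristic_polynomial G) 0)"
  then obtain k and h :: "sym_tensor \<Rightarrow> complex" where
    h: "\<And>G :: (nat, nat) multigraph. is_graph G \<Longrightarrow>
      partition_function k h G = poly (characteristic_polynomial G) 0"
    by blast
  define B where "B = mat k k (\<lambda>(i, j). h (basis_vec (Suc i) * basis_vec (Suc j)))"
  have B: "B \<in> carrier_mat k k" by (simp add: B_def)
  have trace: "mat_trace (B ^\<^sub>m Suc n) = poly (characteristic_polynomial (cycle_graph n)) 0" for n
    using h[OF is_graph_cycle, of n] by (simp add: partition_function_cycle B_def)
  have "mat_trace B = 0"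
  proof (rule mat_trace_zero_of_pow_traces_zero[OF B])
    fix m :: nat assume "m > 0"
    then have n: "Suc (4 * m - 1) = 4 * m" by simp
    show "mat_trace (B ^\<^sub>m (4 * m)) = 0"
      using trace[of "4 * m - 1"] characteristic_polynomial_cycle_4[OF n] by (simp only: n)
  qed simp
  moreover have "mat_trace B = -2"
    using trace[of 0] B by (simp add: characteristic_polynomial_loop)
  ultimately show False by simp
qed

end
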